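(* Let $G,H,K$ be finite simple graphs. Then the product $\cdot$ is compatible with the join addition $+$ in the sense that the distributive law $$G\cdot(H+K)=G\cdot H+G\cdot K$$ holds (equality meaning graph isomorphism).
   Context: The (Zykov) join $H+K$ of two graphs is the disjoint union of $H$ and $K$ with all edges between a vertex of $H$ and a vertex of $K$ added. For graphs $G=(V,E)$ and $H=(W,F)$, the product $G\cdot H$ is the graph with vertex set $V\times W$ in which $(a,b)$ and $(c,d)$ are adjacent if and only if $(a,c)\in E$ or $(b,d)\in F$. *)

theory Defs
  imports "Graph_Theory.Pair_Digraph" "Graph_Theory.Digraph_Isomorphism"
begin

text \<open>
  Finite simple graphs are the \<^locale>\<open>pair_graph\<close>s: finite, loop-free, symmetric digraphs
  without parallel arcs. An undirected edge between \<open>u\<close> and \<open>v\<close> is the pair of arcs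
  \<open>(u, v)\<close> and \<open>(v, u)\<close>.
\<close>

definition graph_join :: "'a pair_pre_digraph \<Rightarrow> 'b pair_pre_digraph \<Rightarrow> ('a + 'b) pair_pre_digraph"
  where "graph_join H K = \<lparr>
    pverts = pverts H <+> pverts K,
    parcs = {(Inl u, Inl v) | u v. (u, v) \<in> parcs H}
          \<union> {(Inr u, Inr v) | u v. (u, v) \<in> parcs K}
          \<union> {(Inl u, Inr v) | u v. u \<in> pverts H \<and> v \<in> pverts K}
          \<union> {(Inr v, Inl u) | u v. u \<in> pverts H \<and> v \<in> pverts K} \<rparr>"

definition graph_product :: "'a pair_pre_digraph \<Rightarrow> 'b pair_pre_digraph \<Rightarrow> ('a \<times> 'b) pair_pre_digraph"
  where "graph_product G H = \<lparr>
    pverts = pverts G \<times> pverts H,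
    parcs = {((a, b), (c, d)) | a b c d.
      (a, b) \<in> pverts G \<times> pverts H \<and> (c, d) \<in> pverts G \<times> pverts H \<and>
      ((a, c) \<in> parcs G \<or> (b, d) \<in> parcs H)} \<rparr>"

lemma pair_graphI:
  assumes "finite (pverts G)" "parcs G \<subseteq> pverts G \<times> pverts G" "sym (parcs G)" "irrefl (parcs G)"
  shows "pair_graph G"
proof
  show "finite (parcs G)"
    using assms(1,2) by (meson finite_SigmaI finite_subset)
  show "symmetric (with_proj G)"
    using assms(3) by (simp add: symmetric_def)
qed (use assms in \<open>auto simp: irrefl_def\<close>)

lemma pair_graphD:
  assumes "pair_graph G"
  shows "finite (pverts G)" "parcs G \<subseteq> pverts G \<times> pverts G" "sym (parcs G)" "irrefl (parcs G)"
proof -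
  interpret pair_graph G by fact
  show "finite (pverts G)" by (rule pair_finite_verts)
  show "parcs G \<subseteq> pverts G \<times> pverts G" by (auto dest: in_arcsD1 in_arcsD2)
  show "sym (parcs G)" using pair_sym_arcs by (simp add: symmetric_def)
  show "irrefl (parcs G)" by (auto simp: irrefl_def dest: pair_no_loops)
qed

lemma pair_graph_graph_join:
  assumes "pair_graph H" "pair_graph K"
  shows "pair_graph (graph_join H K)"
  using pair_graphD[OF assms(1)] pair_graphD[OF assms(2)]
  by (intro pair_graphI) (auto simp: graph_join_def irrefl_def intro!: symI dest: symD)

lemma pair_graph_graph_product:
  assumes "pair_graph G" "pair_graph H"
  shows "pair_graph (graph_product G H)"
  using pair_graphD[OF assms(1)] pair_graphD[OF assms(2)]
  by (intro pair_graphI) (auto simp: graph_product_def irrefl_def intro!: symI dest: symD)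

end

theory Submission
  imports Defs
begin

text \<open>The map sending (a, s) to (a, b) in the summand that contains s is an isomorphism. If s
  and t lie in the same summand, adjacency of (a, s) and (c, t) is that of the product of
  \<open>G\<close> with that summand. If they lie in different summands, s and t are adjacent in the
  join, so the pairs are adjacent whatever a and c are, exactly as the outer join demands.\<close>

text \<open>An arc here is the pair of its ends, so the vertex bijection already determines the arc
  map \<open>map_prod f f\<close>.\<close>

lemma digraph_iso_with_projI:
  assumes wf: "pair_wf_digraph G"
    and f: "bij_betw f (pverts G) (pverts H)"
    and arcs: "parcs H = map_prod f f ` parcs G"
  shows "digraph_iso (with_proj G) (with_proj H)"
proof -
  interpret pair_wf_digraph G by (rule wf)
  let ?h = "\<lparr>iso_verts = f, iso_arcs = map_prod f f, iso_head = snd, iso_tail = fst\<rparr>"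
  have inj: "inj_on f (pverts G)"
    using f by (rule bij_betw_imp_inj_on)
  moreover have "inj_on (map_prod f f) (parcs G)"
    \<comment> \<open>Well-formedness puts the arcs inside
      \<open>pverts G \<times> pverts G\<close>, where \<open>map_prod f f\<close> is
      injective.\<close>
    using map_prod_inj_on[OF inj inj] by (rule inj_on_subset) (auto dest: in_arcsD1 in_arcsD2)
  ultimately have "digraph_isomorphism ?h"
    by (simp add: digraph_isomorphism_def wf_digraph_axioms)
  moreover have "with_proj H = app_iso ?h (with_proj G)"
    using f arcs by (simp add: app_iso_def with_proj_def bij_betw_imp_surj_on)
  ultimately show ?thesis
    unfolding digraph_iso_def by blast
qed

theorem lemma15:
  fixes G :: "'a pair_pre_digraph" and H :: "'b pair_pre_digraph" and K :: "'c pair_pre_digraph"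
  assumes "pair_graph G" and "pair_graph H" and "pair_graph K"
  shows "digraph_iso (with_proj (graph_product G (graph_join H K)))
                     (with_proj (graph_join (graph_product G H) (graph_product G K)))"
proof (rule digraph_iso_with_projI)
  let ?L = "graph_product G (graph_join H K)"
  let ?R = "graph_join (graph_product G H) (graph_product G K)"
  let ?f = "\<lambda>(a, s). case s of Inl b \<Rightarrow> Inl (a, b) | Inr c \<Rightarrow> Inr (a, c)"
  let ?g = "case_sum (map_prod id Inl) (map_prod id Inr)"
  note graph_defs = graph_product_def graph_join_def
  interpret L: pair_graph ?L
    by (intro pair_graph_graph_product pair_graph_graph_join assms)
  show "pair_wf_digraph ?L"
    by (rule L.pair_wf_digraph_axioms)
  show "bij_betw ?f (pverts ?L) (pverts ?R)"
    by (rule bij_betw_byWitness[where f' = ?g]) (auto simp: graph_defs)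
  show "parcs ?R = map_prod ?f ?f ` parcs ?L"
  proof (intro subset_antisym subsetI)
    fix e assume "e \<in> parcs ?R"
    \<comment> \<open>The preimage of \<open>e\<close> is given explicitly by \<open>?g\<close>, a
      right inverse of \<open>?f\<close> on the whole sum type.\<close>
    then have "map_prod ?g ?g e \<in> parcs ?L"
      by (auto simp: graph_defs)
    moreover have "e = map_prod ?f ?f (map_prod ?g ?g e)"
      by (cases e) (auto split: sum.split)
    ultimately show "e \<in> map_prod ?f ?f ` parcs ?L"
      by (rule rev_image_eqI)
  qed (auto simp: graph_defs)
qed

end
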